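(* Let $G$ be a compact Lie group with Lie algebra $\mathfrak g$, $X\in\mathfrak g$, $q\in C^\infty(G)$, and $q_0=\int_Gq(x)\,dx$. Let $L_q=X+q$ and $L_{q_0}=X+q_0$. Assume that there exists $Q\in C^\infty(G)$ such that $XQ=q-q_0$. Then $L_q$ is globally solvable if and only if $L_{q_0}$ is globally solvable.
   Context: $C^\infty(G)$ denotes complex-valued smooth functions, $\mathcal D'(G)$ the space of distributions (continuous linear functionals on the Fréchet space $C^\infty(G)$), $dx$ the normalized Haar measure, and $\widehat G$ the set of equivalence classes of continuous irreducible unitary representations; $\xi$ denotes a matrix-valued representative $\xi:G\to\mathbb C^{d_\xi\times d_\xi}$ of $[\xi]\in\widehat G$, $d_\xi=\dim\xi$. $X$ acts as the left-invariant vector field $Xf(x)=\frac{d}{dt}f(x\exp(tX))|_{t=0}$. The symbol of $X$ at $\xi$ is $\sigma_X(\xi)=\xi(x)^*(X\xi)(x)$, independent of $x$. For each $[\xi]\in\widehat G$ one fixes a representative such that $\sigma_X(\xi)_{mn}=i\lambda_m(\xi)\delta_{mn}$ with $\lambda_m(\xi)\in\mathbb R$, $1\le m,n\le d_\xi$; this is always possible. The Fourier coefficients of $u\in\mathcal D'(G)$ are $\widehat u(\xi)_{mn}=\langle u,\overline{\xi_{nm}}\rangle$ (functions being identified with distributions via normalized Haar measure). For $q\in C^\infty(G)$, $L_qu=Xu+qu$ for $u\in C^\infty(G)$, extended to $u\in\mathcal D'(G)$ by $\langle L_qu,\varphi\rangle=-\langle u,X\varphi\rangle+\langle u,q\varphi\rangle$,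 $\varphi\in C^\infty(G)$. For the constant $q_0\in\mathbb C$ let $\mathcal K_{q_0}=\{w\in\mathcal D'(G):\ \widehat w(\xi)_{mn}=0\ \text{whenever}\ \lambda_m(\xi)-iq_0=0,\ 1\le m,n\le d_\xi\}$; $L_{q_0}$ is globally solvable if $L_{q_0}(\mathcal D'(G))=\mathcal K_{q_0}$. The operator $L_q$, $q\in C^\infty(G)$, is globally solvable if there is $Q\in C^\infty(G)$ with $XQ=q-q_0$ and $L_q(\mathcal D'(G))=\mathcal J_q$, where $\mathcal J_q=\{v\in\mathcal D'(G):\ e^Qv\in\mathcal K_{q_0}\}$. *)

theory Defs
  imports
    "HOL-Analysis.Analysis"
    "Jordan_Normal_Form.Schur_Decomposition"
    "Jordan_Normal_Form.VS_Connect"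
begin

section \<open>Smooth maps and smooth manifolds\<close>

text \<open>The iterated directional derivative \<open>D\<^sub>v\<^sub>k \<dots> D\<^sub>v\<^sub>1 g\<close> along the list \<open>[v\<^sub>1, \<dots>, v\<^sub>k]\<close>.\<close>

primrec iter_deriv ::
  "'a::real_normed_vector list \<Rightarrow> ('a \<Rightarrow> 'b::real_normed_vector) \<Rightarrow> 'a \<Rightarrow> 'b" where
  "iter_deriv [] g = g"
| "iter_deriv (v # vs) g = iter_deriv vs (\<lambda>x. frechet_derivative g (at x) v)"

text \<open>On an open subset of a finite-dimensional space this is the usual class \<open>C\<^sup>k\<close>.\<close>

primrec Ck_on ::
  "nat \<Rightarrow> 'a::real_normed_vector set \<Rightarrow> ('a \<Rightarrow> 'b::real_normed_vector) \<Rightarrow> bool" where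
  "Ck_on 0 S g \<longleftrightarrow> continuous_on S g"
| "Ck_on (Suc k) S g \<longleftrightarrow>
     (\<forall>x\<in>S. g differentiable (at x)) \<and> (\<forall>v. Ck_on k S (\<lambda>x. frechet_derivative g (at x) v))"

definition smooth_on ::
  "'a::real_normed_vector set \<Rightarrow> ('a \<Rightarrow> 'b::real_normed_vector) \<Rightarrow> bool" where
  "smooth_on S g \<longleftrightarrow> (\<forall>k. Ck_on k S g)"

text \<open>A chart is a pair \<open>(U, \<phi>)\<close>; only the restriction of \<open>\<phi>\<close> to \<open>U\<close> is relevant.
  The model space is a finite-dimensional normed space rather than a type of class
  \<open>euclidean_space\<close>, since the latter excludes dimension 0 (finite groups).\<close>

type_synonym ('p, 'e) atlas = "('p set \<times> ('p \<Rightarrow> 'e)) set"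

definition smooth_atlas ::
  "('p::topological_space, 'e::real_normed_vector) atlas \<Rightarrow> bool" where
  "smooth_atlas A \<longleftrightarrow>
     (\<exists>B::'e set. finite B \<and> Real_Vector_Spaces.span B = UNIV) \<and>
     (\<Union>(U, \<phi>)\<in>A. U) = UNIV \<and>
     (\<forall>(U, \<phi>)\<in>A. open U \<and> open (\<phi> ` U) \<and> homeomorphism U (\<phi> ` U) \<phi> (inv_into U \<phi>)) \<and>
     (\<forall>(U, \<phi>)\<in>A. \<forall>(V, \<psi>)\<in>A. smooth_on (\<phi> ` (U \<inter> V)) (\<psi> \<circ> inv_into U \<phi>))"

definition std_atlas :: "('e::real_normed_vector, 'e) atlas" where
  "std_atlas = {(UNIV, id)}"

definition prod_atlas :: "('p, 'e) atlas \<Rightarrow> ('r, 'f) atlas \<Rightarrow> ('p \<times> 'r, 'e \<times> 'f) atlas" where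
  "prod_atlas A B = {(U \<times> V, map_prod \<phi> \<psi>) | U \<phi> V \<psi>. (U, \<phi>) \<in> A \<and> (V, \<psi>) \<in> B}"

definition smooth_map ::
  "('p::topological_space, 'e::real_normed_vector) atlas \<Rightarrow>
   ('r::topological_space, 'f::real_normed_vector) atlas \<Rightarrow> ('p \<Rightarrow> 'r) \<Rightarrow> bool" where
  "smooth_map A B f \<longleftrightarrow>
     continuous_on UNIV f \<and>
     (\<forall>(U, \<phi>)\<in>A. \<forall>(V, \<psi>)\<in>B. smooth_on (\<phi> ` (U \<inter> f -` V)) (\<psi> \<circ> f \<circ> inv_into U \<phi>))"


section \<open>Compact Lie groups\<close>

class group_mult = monoid_mult + inverse +
  assumes left_inverse_mult: "inverse a * a = 1"
    and divide_conv_mult_inverse: "a / b = a * inverse b"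

text \<open>The group is a type, with its topology (Hausdorff and second countable by its sort) and
  its group operations; the smooth structure is given by an atlas.\<close>

definition compact_lie_group ::
  "('g::{group_mult,t2_space,second_countable_topology}, 'e::real_normed_vector) atlas \<Rightarrow> bool"
  where
  "compact_lie_group A \<longleftrightarrow>
     smooth_atlas A \<and>
     smooth_map (prod_atlas A A) A (\<lambda>(x, y). x * y) \<and>
     smooth_map A A inverse \<and>
     compact (UNIV :: 'g set)"

definition normalized_haar ::
  "'g::{group_mult,t2_space,second_countable_topology} measure \<Rightarrow> bool" where
  "normalized_haar M \<longleftrightarrow>
     sets M = sets borel \<and> emeasure M UNIV = 1 \<and> (\<forall>x. distr M borel (\<lambda>y. x * y) = M)"

text \<open>The Lie algebra is taken in its model as the set \<open>Hom(\<real>, G)\<close> of smooth one-parameter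
  subgroups (see e.g. Hofmann and Morris, The Structure of Compact Groups): an element \<open>X\<close> is
  the homomorphism \<open>t \<mapsto> exp(tX)\<close>.  So \<open>exp X = X 1\<close>, and \<open>tX\<close> is the reparametrisation
  \<open>s \<mapsto> X (ts)\<close>.\<close>

definition lie_algebra ::
  "('g::{group_mult,t2_space,second_countable_topology}, 'e::real_normed_vector) atlas \<Rightarrow>
   (real \<Rightarrow> 'g) set" where
  "lie_algebra A =
     {X. smooth_map (std_atlas :: (real, real) atlas) A X \<and> (\<forall>s t. X (s + t) = X s * X t)}"

definition lie_exp :: "(real \<Rightarrow> 'g) \<Rightarrow> 'g" where
  "lie_exp X = X 1"

definition lie_scale :: "real \<Rightarrow> (real \<Rightarrow> 'g) \<Rightarrow> real \<Rightarrow> 'g" where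
  "lie_scale t X = (\<lambda>s. X (t * s))"

definition left_inv_field ::
  "(real \<Rightarrow> 'g::group_mult) \<Rightarrow> ('g \<Rightarrow> complex) \<Rightarrow> 'g \<Rightarrow> complex" where
  "left_inv_field X f x = vector_derivative (\<lambda>t. f (x * lie_exp (lie_scale t X))) (at 0)"


section \<open>Smooth functions and distributions\<close>

definition C_infinity ::
  "('g::topological_space, 'e::real_normed_vector) atlas \<Rightarrow> ('g \<Rightarrow> complex) set" where
  "C_infinity A = {f. smooth_map A (std_atlas :: (complex, complex) atlas) f}"

text \<open>The Frechet topology of \<open>C\<^sup>\<infinity>(G)\<close>: uniform convergence of all derivatives on compact subsets
  of charts.\<close>

definition C_infinity_topology ::
  "('g::topological_space, 'e::real_normed_vector) atlas \<Rightarrow> ('g \<Rightarrow> complex) topology" where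
  "C_infinity_topology A = topology_generated_by
     {{g \<in> C_infinity A. \<forall>y\<in>K.
         norm (iter_deriv vs (g \<circ> inv_into U \<phi>) y - iter_deriv vs (f \<circ> inv_into U \<phi>) y) < \<epsilon>}
       | f U \<phi> K vs \<epsilon>.
         f \<in> C_infinity A \<and> (U, \<phi>) \<in> A \<and> compact K \<and> K \<subseteq> \<phi> ` U \<and> (0::real) < \<epsilon>}"

text \<open>Distributions are total functions in HOL; extensionality makes two of them equal as soon
  as they agree on \<open>C\<^sup>\<infinity>(G)\<close>.\<close>

definition distributions ::
  "('g::topological_space, 'e::real_normed_vector) atlas \<Rightarrow> (('g \<Rightarrow> complex) \<Rightarrow> complex) set" where
  "distributions A =
     {u. u \<in> extensional (C_infinity A) \<and>
         (\<forall>f\<in>C_infinity A. \<forall>g\<in>C_infinity A. u (\<lambda>x. f x + g x) = u f + u g) \<and>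
         (\<forall>f\<in>C_infinity A. \<forall>c. u (\<lambda>x. c * f x) = c * u f) \<and>
         continuous_map (C_infinity_topology A) euclidean u}"

definition mult_distribution ::
  "('g::topological_space, 'e::real_normed_vector) atlas \<Rightarrow> ('g \<Rightarrow> complex) \<Rightarrow>
   (('g \<Rightarrow> complex) \<Rightarrow> complex) \<Rightarrow> ('g \<Rightarrow> complex) \<Rightarrow> complex" where
  "mult_distribution A h v = restrict (\<lambda>f. v (\<lambda>x. h x * f x)) (C_infinity A)"

text \<open>The operator \<open>L\<^sub>q = X + q\<close> on distributions.\<close>

definition L_op ::
  "('g::{group_mult,t2_space,second_countable_topology}, 'e::real_normed_vector) atlas \<Rightarrow>
   (real \<Rightarrow> 'g) \<Rightarrow> ('g \<Rightarrow> complex) \<Rightarrow>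
   (('g \<Rightarrow> complex) \<Rightarrow> complex) \<Rightarrow> ('g \<Rightarrow> complex) \<Rightarrow> complex" where
  "L_op A X q u =
     restrict (\<lambda>f. - u (left_inv_field X f) + u (\<lambda>x. q x * f x)) (C_infinity A)"


section \<open>The unitary dual and Fourier coefficients\<close>

definition rep_dim :: "('g::group_mult \<Rightarrow> complex mat) \<Rightarrow> nat" where
  "rep_dim \<xi> = dim_row (\<xi> 1)"

definition unitary_rep ::
  "('g::{group_mult,topological_space} \<Rightarrow> complex mat) \<Rightarrow> bool" where
  "unitary_rep \<xi> \<longleftrightarrow>
     (\<forall>x. \<xi> x \<in> carrier_mat (rep_dim \<xi>) (rep_dim \<xi>)) \<and>
     (\<forall>x. mat_adjoint (\<xi> x) * \<xi> x = 1\<^sub>m (rep_dim \<xi>)) \<and>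
     (\<forall>x y. \<xi> (x * y) = \<xi> x * \<xi> y) \<and>
     (\<forall>m<rep_dim \<xi>. \<forall>n<rep_dim \<xi>. continuous_on UNIV (\<lambda>x. \<xi> x $$ (m, n)))"

definition irreducible_rep :: "('g::group_mult \<Rightarrow> complex mat) \<Rightarrow> bool" where
  "irreducible_rep \<xi> \<longleftrightarrow>
     0 < rep_dim \<xi> \<and>
     (\<forall>W. VectorSpace.subspace class_ring W (module_vec TYPE(complex) (rep_dim \<xi>)) \<longrightarrow>
          (\<forall>x. \<forall>w\<in>W. \<xi> x *\<^sub>v w \<in> W) \<longrightarrow>
          W = {0\<^sub>v (rep_dim \<xi>)} \<or> W = carrier_vec (rep_dim \<xi>))"

definition irreps :: "('g::{group_mult,topological_space} \<Rightarrow> complex mat) set" where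
  "irreps = {\<xi>. unitary_rep \<xi> \<and> irreducible_rep \<xi>}"

definition rep_equiv ::
  "(('g::{group_mult,topological_space} \<Rightarrow> complex mat) \<times> ('g \<Rightarrow> complex mat)) set" where
  "rep_equiv = {(\<xi>, \<eta>). \<xi> \<in> irreps \<and> \<eta> \<in> irreps \<and> rep_dim \<xi> = rep_dim \<eta> \<and>
     (\<exists>S\<in>carrier_mat (rep_dim \<xi>) (rep_dim \<xi>). invertible_mat S \<and> (\<forall>x. S * \<xi> x = \<eta> x * S))}"

definition unitary_dual :: "('g::{group_mult,topological_space} \<Rightarrow> complex mat) set set" where
  "unitary_dual = irreps // rep_equiv"

definition symbol ::
  "(real \<Rightarrow> 'g::group_mult) \<Rightarrow> ('g \<Rightarrow> complex mat) \<Rightarrow> 'g \<Rightarrow> complex mat" where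
  "symbol X \<xi> x =
     mat_adjoint (\<xi> x) *
     mat (rep_dim \<xi>) (rep_dim \<xi>) (\<lambda>(m, n). left_inv_field X (\<lambda>y. \<xi> y $$ (m, n)) x)"

text \<open>The symbol does not depend on the point, so it may be evaluated at the identity.\<close>

definition symbol_eigenvalue ::
  "(real \<Rightarrow> 'g::group_mult) \<Rightarrow> ('g \<Rightarrow> complex mat) \<Rightarrow> nat \<Rightarrow> real" where
  "symbol_eigenvalue X \<xi> m = Im (symbol X \<xi> 1 $$ (m, m))"

definition diagonalizing_representatives ::
  "(real \<Rightarrow> 'g::{group_mult,topological_space}) \<Rightarrow>
   (('g \<Rightarrow> complex mat) set \<Rightarrow> 'g \<Rightarrow> complex mat) \<Rightarrow> bool" where
  "diagonalizing_representatives X rep \<longleftrightarrow>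
     (\<forall>c\<in>unitary_dual. rep c \<in> c \<and>
        (\<forall>x. \<forall>m<rep_dim (rep c). \<forall>n<rep_dim (rep c).
           symbol X (rep c) x $$ (m, n) =
             (if m = n then \<i> * of_real (symbol_eigenvalue X (rep c) m) else 0)))"

definition fourier_coeff ::
  "(('g \<Rightarrow> complex) \<Rightarrow> complex) \<Rightarrow> ('g \<Rightarrow> complex mat) \<Rightarrow> nat \<Rightarrow> nat \<Rightarrow> complex" where
  "fourier_coeff u \<xi> m n = u (\<lambda>x. cnj (\<xi> x $$ (n, m)))"


section \<open>Global solvability\<close>

definition K_space ::
  "('g::{group_mult,t2_space,second_countable_topology}, 'e::real_normed_vector) atlas \<Rightarrow>
   (real \<Rightarrow> 'g) \<Rightarrow> (('g \<Rightarrow> complex mat) set \<Rightarrow> 'g \<Rightarrow> complex mat) \<Rightarrow> complex \<Rightarrow>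
   (('g \<Rightarrow> complex) \<Rightarrow> complex) set" where
  "K_space A X rep q0 =
     {w \<in> distributions A.
        \<forall>c\<in>unitary_dual. \<forall>m<rep_dim (rep c). \<forall>n<rep_dim (rep c).
          of_real (symbol_eigenvalue X (rep c) m) - \<i> * q0 = 0 \<longrightarrow>
          fourier_coeff w (rep c) m n = 0}"

definition J_space ::
  "('g::{group_mult,t2_space,second_countable_topology}, 'e::real_normed_vector) atlas \<Rightarrow>
   (real \<Rightarrow> 'g) \<Rightarrow> (('g \<Rightarrow> complex mat) set \<Rightarrow> 'g \<Rightarrow> complex mat) \<Rightarrow> complex \<Rightarrow>
   ('g \<Rightarrow> complex) \<Rightarrow> (('g \<Rightarrow> complex) \<Rightarrow> complex) set" where
  "J_space A X rep q0 Q =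
     {v \<in> distributions A. mult_distribution A (\<lambda>x. exp (Q x)) v \<in> K_space A X rep q0}"

definition globally_solvable_const ::
  "('g::{group_mult,t2_space,second_countable_topology}, 'e::real_normed_vector) atlas \<Rightarrow>
   (real \<Rightarrow> 'g) \<Rightarrow> (('g \<Rightarrow> complex mat) set \<Rightarrow> 'g \<Rightarrow> complex mat) \<Rightarrow> complex \<Rightarrow> bool" where
  "globally_solvable_const A X rep q0 \<longleftrightarrow>
     L_op A X (\<lambda>x. q0) ` distributions A = K_space A X rep q0"

definition globally_solvable ::
  "('g::{group_mult,t2_space,second_countable_topology}, 'e::real_normed_vector) atlas \<Rightarrow>
   'g measure \<Rightarrow> (real \<Rightarrow> 'g) \<Rightarrow> (('g \<Rightarrow> complex mat) set \<Rightarrow> 'g \<Rightarrow> complex mat) \<Rightarrow>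
   ('g \<Rightarrow> complex) \<Rightarrow> bool" where
  "globally_solvable A M X rep q \<longleftrightarrow>
     (let q0 = (LINT x|M. q x) in
        \<exists>Q\<in>C_infinity A. (\<forall>x. left_inv_field X Q x = q x - q0) \<and>
          L_op A X q ` distributions A = J_space A X rep q0 Q)"

end

(* Multiplication by e^Q is a bijection of D'(G) with inverse multiplication by e^(-Q), and the Leibniz
   rule X(e^Q f) = e^Q X f + (q - q_0) e^Q f gives L_{q_0}(e^Q u) = e^Q L_q u.  So multiplication by e^Q
   maps L_q(D') onto L_{q_0}(D') and J_q onto K_{q_0}, and each of the two equalities of spaces is the
   image of the other.  The analytic content is that e^Q f and X f are smooth and that f |-> e^Q f is
   continuous for the Frechet topology. *)

theory Submission
  imports Defs
begin

section \<open>Calculus on open subsets of normed spaces\<close>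

text \<open>The Fourier conditions never have to be computed: \<open>J_space\<close> is by
  definition the preimage of \<open>K_space\<close> under multiplication by e^Q, so transport along
  a bijection is enough. Both equalities are compared inside the set of all extensional functionals,
  which contains every L_q u by construction. Two obstacles shape the analytic part. The model space
  of an atlas is only a normed space with a finite spanning set, so that finite groups are covered.
  Bounded coordinate functionals must therefore be constructed before a derivative along a variable
  direction, which is what X becomes in a chart, can be shown to be smooth. And the Frechet topology
  is given by generating sets that control one iterated derivative on one compact set. Continuity of
  multiplication is thus a Leibniz estimate with finitely many derivatives, uniform in the test
  function.\<close>

lemma frechet_derivative_cong_open:
  assumes "open S" "x \<in> S" "\<And>y. y \<in> S \<Longrightarrow> f y = g y"
  shows "frechet_derivative f (at x) = frechet_derivative g (at x)"
proof -
  have "(f has_derivative D) (at x) \<longleftrightarrow> (g has_derivative D) (at x)" for D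
    using has_derivative_transform_within_open[OF _ assms(1,2), of f D UNIV g]
      has_derivative_transform_within_open[OF _ assms(1,2), of g D UNIV f] assms(3) by auto
  then show ?thesis
    by (simp add: frechet_derivative_def)
qed

text \<open>No differentiability is assumed: \<open>frechet_derivative\<close> is a choice from the
  set of derivatives, and functions that agree near a point have the same set. Openness of
  \<open>S\<close> carries the agreement through every order.\<close>

lemma iter_deriv_cong_open:
  assumes "open S" "\<And>y. y \<in> S \<Longrightarrow> f y = g y" "x \<in> S"
  shows "iter_deriv vs f x = iter_deriv vs g x"
  using assms(2,3)
proof (induction vs arbitrary: f g)
  case (Cons v vs)
  have "frechet_derivative f (at y) v = frechet_derivative g (at y) v" if "y \<in> S" for y
    using frechet_derivative_cong_open[OF assms(1) that Cons.prems(1)] by simp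
  then show ?case
    using Cons.IH[OF _ Cons.prems(2), of "\<lambda>y. frechet_derivative f (at y) v"
        "\<lambda>y. frechet_derivative g (at y) v"] by simp
qed simp

lemma Ck_on_cong:
  assumes "open S" "\<And>y. y \<in> S \<Longrightarrow> f y = g y" "Ck_on k S f"
  shows "Ck_on k S g"
  using assms(2,3)
proof (induction k arbitrary: f g)
  case 0
  then show ?case using continuous_on_cong by force
next
  case (Suc k)
  have "g differentiable (at x)" if "x \<in> S" for x
    using Suc.prems that has_derivative_transform_within_open[OF _ assms(1) that, of f _ UNIV g]
    by (simp add: differentiable_def) blast
  moreover have "Ck_on k S (\<lambda>x. frechet_derivative g (at x) v)" for v
    using Suc.IH[of "\<lambda>x. frechet_derivative f (at x) v" "\<lambda>x. frechet_derivative g (at x) v"]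
      Suc.prems frechet_derivative_cong_open[OF assms(1), of _ f g] by simp
  ultimately show ?case by simp
qed

text \<open>Replaces the chosen derivative by an explicit formula \<open>g'\<close>. Each closure
  rule below supplies its own differentiation formula here and then applies the induction hypothesis
  to it.\<close>

lemma Ck_on_SucI:
  assumes "open S" "\<And>x. x \<in> S \<Longrightarrow> (g has_derivative g' x) (at x)"
    and "\<And>v. Ck_on k S (\<lambda>x. g' x v)"
  shows "Ck_on (Suc k) S g"
proof -
  have "Ck_on k S (\<lambda>x. frechet_derivative g (at x) v)" for v
    by (rule Ck_on_cong[OF assms(1) _ assms(3)[of v]])
      (simp add: frechet_derivative_at[OF assms(2)])
  then show ?thesis
    using assms(2) by (auto simp: differentiable_def)
qed

lemma Ck_on_has_derivative:
  "Ck_on (Suc k) S g \<Longrightarrow> x \<in> S \<Longrightarrow> (g has_derivative frechet_derivative g (at x)) (at x)"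
  by (simp add: frechet_derivative_works)

text \<open>Needed for products: the product rule leaves one factor undifferentiated, and its order
  must be lowered to \<open>k\<close> before the induction hypothesis applies.\<close>

lemma Ck_on_Suc_imp: "Ck_on (Suc k) S g \<Longrightarrow> Ck_on k S g"
proof (induction k arbitrary: g)
  case 0
  then show ?case
    by (auto intro!: continuous_at_imp_continuous_on differentiable_imp_continuous_within)
next
  case (Suc k)
  then show ?case by (metis Ck_on.simps(2))
qed

lemma Ck_on_bounded_linear:
  assumes "open S" "bounded_linear L" "Ck_on k S f"
  shows "Ck_on k S (\<lambda>x. L (f x))"
  using assms(3)
proof (induction k arbitrary: f)
  case 0
  then show ?case
    using bounded_linear.continuous_on[OF assms(2)] by simp
next
  case (Suc k)
  show ?case
  proof (rule Ck_on_SucI[OF assms(1)])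
    show "((\<lambda>x. L (f x)) has_derivative (\<lambda>v. L (frechet_derivative f (at x) v))) (at x)"
      if "x \<in> S" for x
      by (rule bounded_linear.has_derivative[OF assms(2) Ck_on_has_derivative[OF Suc.prems that]])
    show "Ck_on k S (\<lambda>x. L (frechet_derivative f (at x) v))" for v
      using Suc by simp
  qed
qed

lemma Ck_on_const: "open S \<Longrightarrow> Ck_on k S (\<lambda>x. c)"
proof (induction k arbitrary: c)
  case (Suc k)
  show ?case
    by (rule Ck_on_SucI[where g' = "\<lambda>x v. 0"]) (use Suc in simp_all)
qed simp

lemma Ck_on_add:
  assumes "open S" "Ck_on k S f" "Ck_on k S g"
  shows "Ck_on k S (\<lambda>x. f x + g x)"
  using assms(2,3)
proof (induction k arbitrary: f g)
  case 0
  then show ?case by (simp add: continuous_on_add)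
next
  case (Suc k)
  show ?case
    by (rule Ck_on_SucI[OF assms(1) has_derivative_add[OF Ck_on_has_derivative[OF Suc.prems(1)]
            Ck_on_has_derivative[OF Suc.prems(2)]]])
      (use Suc in simp_all)
qed

lemma Ck_on_bilinear:
  assumes "open S" "bounded_bilinear pr" "Ck_on k S f" "Ck_on k S g"
  shows "Ck_on k S (\<lambda>x. pr (f x) (g x))"
  using assms(3,4)
proof (induction k arbitrary: f g)
  case 0
  then show ?case
    using bounded_bilinear.continuous_on[OF assms(2)] by simp
next
  case (Suc k)
  show ?case
  proof (rule Ck_on_SucI[OF assms(1) bounded_bilinear.FDERIV[OF assms(2)
          Ck_on_has_derivative[OF Suc.prems(1)] Ck_on_has_derivative[OF Suc.prems(2)]]])
    show "Ck_on k S (\<lambda>x. pr (f x) (frechet_derivative g (at x) v) +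
        pr (frechet_derivative f (at x) v) (g x))" for v
      using Suc.prems Ck_on_Suc_imp[OF Suc.prems(1)] Ck_on_Suc_imp[OF Suc.prems(2)]
      by (intro Ck_on_add[OF assms(1)] Suc.IH) simp_all
  qed
qed

lemma Ck_on_exp:
  fixes f :: "'a::real_normed_vector \<Rightarrow> complex"
  assumes "open S" "Ck_on k S f"
  shows "Ck_on k S (\<lambda>x. exp (f x))"
  using assms(2)
proof (induction k arbitrary: f)
  case 0
  then show ?case by (simp add: continuous_on_exp)
next
  case (Suc k)
  show ?case
  proof (rule Ck_on_SucI[OF assms(1)])
    show "((\<lambda>x. exp (f x)) has_derivative (\<lambda>v. exp (f x) * frechet_derivative f (at x) v)) (at x)"
      if "x \<in> S" for x
      using has_derivative_compose[OF Ck_on_has_derivative[OF Suc.prems that]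
          DERIV_exp[unfolded has_field_derivative_def]] .
    show "Ck_on k S (\<lambda>x. exp (f x) * frechet_derivative f (at x) v)" for v
      by (rule Ck_on_bilinear[OF assms(1) bounded_bilinear_mult])
        (use Suc Ck_on_Suc_imp[OF Suc.prems] in simp_all)
  qed
qed

text \<open>Freezing the second variable amounts to differentiating only in directions
  \<open>(v, 0)\<close>. With \<open>c\<close> the chart image of the identity, this gives
  smoothness of the coefficient field of X.\<close>

lemma Ck_on_slice:
  assumes "open S" "Ck_on k R g" "\<And>y. y \<in> S \<Longrightarrow> (y, c) \<in> R"
  shows "Ck_on k S (\<lambda>y. g (y, c))"
  using assms(2)
proof (induction k arbitrary: g)
  case 0
  have "continuous_on S (\<lambda>y. (y, c))"
    by (intro continuous_intros)
  then show ?case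
    using 0 continuous_on_compose2[of R g S "\<lambda>y. (y, c)"] assms(3) by auto
next
  case (Suc k)
  show ?case
  proof (rule Ck_on_SucI[OF assms(1)])
    show "((\<lambda>y. g (y, c)) has_derivative (\<lambda>v. frechet_derivative g (at (y, c)) (v, 0))) (at y)"
      if "y \<in> S" for y
    proof -
      have "((\<lambda>y. (y, c)) has_derivative (\<lambda>v. (v, 0))) (at y)"
        by (intro has_derivative_Pair has_derivative_ident has_derivative_const)
      from has_derivative_compose[OF this Ck_on_has_derivative[OF Suc.prems assms(3)[OF that]]]
      show ?thesis .
    qed
    show "Ck_on k S (\<lambda>y. frechet_derivative g (at (y, c)) (v, 0))" for v
      using Suc.IH[of "\<lambda>z. frechet_derivative g (at z) (v, 0)"] Suc.prems by simp
  qed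
qed

section \<open>Closure properties of smooth functions\<close>

lemma smooth_on_has_derivative:
  "smooth_on S g \<Longrightarrow> x \<in> S \<Longrightarrow> (g has_derivative frechet_derivative g (at x)) (at x)"
  unfolding smooth_on_def using Ck_on_has_derivative by blast

lemma smooth_on_frechet_derivative:
  "smooth_on S g \<Longrightarrow> smooth_on S (\<lambda>x. frechet_derivative g (at x) v)"
  unfolding smooth_on_def by (metis Ck_on.simps(2))

lemma smooth_on_continuous: "smooth_on S g \<Longrightarrow> continuous_on S g"
  unfolding smooth_on_def by (metis Ck_on.simps(1))

lemma smooth_on_cong:
  "open S \<Longrightarrow> (\<And>y. y \<in> S \<Longrightarrow> f y = g y) \<Longrightarrow> smooth_on S f \<Longrightarrow> smooth_on S g"
  unfolding smooth_on_def by (blast intro: Ck_on_cong)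

lemma smooth_on_const: "open S \<Longrightarrow> smooth_on S (\<lambda>x. c)"
  by (simp add: smooth_on_def Ck_on_const)

lemma smooth_on_bounded_linear:
  "open S \<Longrightarrow> bounded_linear L \<Longrightarrow> smooth_on S f \<Longrightarrow> smooth_on S (\<lambda>x. L (f x))"
  by (simp add: smooth_on_def Ck_on_bounded_linear)

lemma smooth_on_add:
  "open S \<Longrightarrow> smooth_on S f \<Longrightarrow> smooth_on S g \<Longrightarrow> smooth_on S (\<lambda>x. f x + g x)"
  by (simp add: smooth_on_def Ck_on_add)

lemma smooth_on_sum:
  "open S \<Longrightarrow> (\<And>i. i \<in> I \<Longrightarrow> smooth_on S (f i)) \<Longrightarrow> smooth_on S (\<lambda>x. \<Sum>i\<in>I. f i x)"
  by (induction I rule: infinite_finite_induct) (simp_all add: smooth_on_const smooth_on_add)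

lemma smooth_on_bilinear:
  "open S \<Longrightarrow> bounded_bilinear pr \<Longrightarrow> smooth_on S f \<Longrightarrow> smooth_on S g \<Longrightarrow>
    smooth_on S (\<lambda>x. pr (f x) (g x))"
  by (simp add: smooth_on_def Ck_on_bilinear)

lemmas smooth_on_mult = smooth_on_bilinear[OF _ bounded_bilinear_mult]

lemma smooth_on_exp:
  fixes f :: "'a::real_normed_vector \<Rightarrow> complex"
  shows "open S \<Longrightarrow> smooth_on S f \<Longrightarrow> smooth_on S (\<lambda>x. exp (f x))"
  by (simp add: smooth_on_def Ck_on_exp)

lemma smooth_on_slice:
  "open S \<Longrightarrow> smooth_on R g \<Longrightarrow> (\<And>y. y \<in> S \<Longrightarrow> (y, c) \<in> R) \<Longrightarrow> smooth_on S (\<lambda>y. g (y, c))"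
  unfolding smooth_on_def by (blast intro: Ck_on_slice)

lemma smooth_on_diff:
  assumes "open S" "smooth_on S f" "smooth_on S g"
  shows "smooth_on S (\<lambda>x. f x - g x)"
  using smooth_on_add[OF assms(1,2) smooth_on_bounded_linear[OF assms(1)
        bounded_linear_minus[OF bounded_linear_ident] assms(3)]] by simp

section \<open>Iterated derivatives of sums and products\<close>

lemma continuous_on_iter_deriv: "smooth_on S f \<Longrightarrow> continuous_on S (iter_deriv vs f)"
proof (induction vs arbitrary: f)
  case Nil
  then show ?case by (simp add: smooth_on_continuous)
next
  case (Cons v vs)
  then show ?case by (simp add: smooth_on_frechet_derivative)
qed

lemma iter_deriv_add:
  assumes "open S" "smooth_on S f" "smooth_on S g" "x \<in> S"
  shows "iter_deriv vs (\<lambda>x. f x + g x) x = iter_deriv vs f x + iter_deriv vs g x"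
  using assms(2,3)
proof (induction vs arbitrary: f g)
  case (Cons v vs)
  have "frechet_derivative (\<lambda>x. f x + g x) (at y) v =
      frechet_derivative f (at y) v + frechet_derivative g (at y) v" if "y \<in> S" for y
    by (rule fun_cong[OF frechet_derivative_at[OF has_derivative_add[OF
              smooth_on_has_derivative[OF Cons.prems(1) that]
              smooth_on_has_derivative[OF Cons.prems(2) that]]], symmetric])
  then have "iter_deriv vs (\<lambda>y. frechet_derivative (\<lambda>x. f x + g x) (at y) v) x =
      iter_deriv vs (\<lambda>y. frechet_derivative f (at y) v + frechet_derivative g (at y) v) x"
    by (rule iter_deriv_cong_open[OF assms(1) _ assms(4)])
  then show ?case
    using Cons.IH[OF smooth_on_frechet_derivative[OF Cons.prems(1)]
        smooth_on_frechet_derivative[OF Cons.prems(2)]] by simp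
qed simp

lemma iter_deriv_diff:
  assumes "open S" "smooth_on S f" "smooth_on S g" "x \<in> S"
  shows "iter_deriv vs (\<lambda>x. f x - g x) x = iter_deriv vs f x - iter_deriv vs g x"
  using iter_deriv_add[OF assms(1) smooth_on_diff[OF assms(1-3)] assms(3,4), of vs] by simp

text \<open>A seminorm form of the Leibniz rule that avoids enumerating the sublists of \<open>vs\<close>.\<close>

lemma iter_deriv_mult_small:
  fixes h :: "'a::real_normed_vector \<Rightarrow> complex"
  assumes "open S" "compact K" "K \<subseteq> S" "smooth_on S h" "0 < \<epsilon>"
  shows "\<exists>W \<delta>. finite W \<and> 0 < \<delta> \<and> (\<forall>g. smooth_on S g \<longrightarrow>
    (\<forall>ws\<in>W. \<forall>y\<in>K. norm (iter_deriv ws g y) < \<delta>) \<longrightarrow>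
    (\<forall>y\<in>K. norm (iter_deriv vs (\<lambda>x. h x * g x) y) < \<epsilon>))"
  using assms(4,5)
proof (induction vs arbitrary: h \<epsilon>)
  case Nil
  have "bounded (h ` K)"
    using assms(2,3) Nil.prems(1) smooth_on_continuous continuous_on_subset
    by (metis compact_continuous_image compact_imp_bounded)
  then obtain C where C: "C > 0" "\<And>y. y \<in> K \<Longrightarrow> norm (h y) \<le> C"
    unfolding bounded_pos by auto
  have "norm (h y * g y) < \<epsilon>" if "y \<in> K" "norm (g y) < \<epsilon> / C" for y and g :: "'a \<Rightarrow> complex"
  proof -
    have "norm (h y * g y) \<le> C * norm (g y)"
      using C(2)[OF that(1)] by (simp add: norm_mult mult_right_mono)
    also have "\<dots> < \<epsilon>"
      using that(2) C(1) by (simp add: pos_less_divide_eq mult.commute)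
    finally show ?thesis .
  qed
  then show ?case
    using C(1) Nil.prems(2) by (intro exI[of _ "{[]}"] exI[of _ "\<epsilon> / C"]) auto
next
  case (Cons v vs)
  let ?D = "\<lambda>f x. frechet_derivative f (at x) v"
  \<comment> \<open>The product rule yields the two terms \<open>?D h x * g x\<close> and
    \<open>h x * ?D g x\<close>; each gets half of \<epsilon>. The first uses the induction
    hypothesis for the derivative of \<open>h\<close>, hence the generalisation over
    \<open>h\<close>.\<close>
  obtain W1 \<delta>1 where 1: "finite W1" "0 < \<delta>1" "\<And>g y. smooth_on S g \<Longrightarrow>
      (\<forall>ws\<in>W1. \<forall>y\<in>K. norm (iter_deriv ws g y) < \<delta>1) \<Longrightarrow> y \<in> K \<Longrightarrow>
      norm (iter_deriv vs (\<lambda>x. ?D h x * g x) y) < \<epsilon> / 2"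
    using Cons.IH[OF smooth_on_frechet_derivative[OF Cons.prems(1), of v], of "\<epsilon> / 2"] Cons.prems(2)
    by auto
  obtain W2 \<delta>2 where 2: "finite W2" "0 < \<delta>2" "\<And>g y. smooth_on S g \<Longrightarrow>
      (\<forall>ws\<in>W2. \<forall>y\<in>K. norm (iter_deriv ws g y) < \<delta>2) \<Longrightarrow> y \<in> K \<Longrightarrow>
      norm (iter_deriv vs (\<lambda>x. h x * g x) y) < \<epsilon> / 2"
    using Cons.IH[OF Cons.prems(1), of "\<epsilon> / 2"] Cons.prems(2) by auto
  \<comment> \<open>Prefixing \<open>v\<close> to the lists in \<open>W2\<close> turns bounds on
    derivatives of \<open>g\<close> into the bounds on derivatives of \<open>?D g\<close> that the
    second term requires.\<close>
  have "norm (iter_deriv (v # vs) (\<lambda>x. h x * g x) y) < \<epsilon>"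
    if g: "smooth_on S g" and y: "y \<in> K"
      and small: "\<forall>ws\<in>W1 \<union> (#) v ` W2. \<forall>y\<in>K. norm (iter_deriv ws g y) < min \<delta>1 \<delta>2" for g y
  proof -
    note Dg = smooth_on_frechet_derivative[OF g, of v]
    note Dh = smooth_on_frechet_derivative[OF Cons.prems(1), of v]
    have "?D (\<lambda>x. h x * g x) z = h z * ?D g z + ?D h z * g z" if "z \<in> S" for z
      by (rule fun_cong[OF frechet_derivative_at[OF has_derivative_mult[OF
                smooth_on_has_derivative[OF Cons.prems(1) that]
                smooth_on_has_derivative[OF g that]]], symmetric])
    then have "iter_deriv (v # vs) (\<lambda>x. h x * g x) y =
        iter_deriv vs (\<lambda>z. h z * ?D g z + ?D h z * g z) y"
      unfolding iter_deriv.simps by (rule iter_deriv_cong_open[OF assms(1) _ subsetD[OF assms(3) y]])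
    also have "\<dots> = iter_deriv vs (\<lambda>z. h z * ?D g z) y + iter_deriv vs (\<lambda>z. ?D h z * g z) y"
      using y assms(1,3) Cons.prems(1) g Dg Dh by (intro iter_deriv_add[of S] smooth_on_mult) auto
    finally have "norm (iter_deriv (v # vs) (\<lambda>x. h x * g x) y) \<le>
        norm (iter_deriv vs (\<lambda>z. h z * ?D g z) y) + norm (iter_deriv vs (\<lambda>z. ?D h z * g z) y)"
      by (simp add: norm_triangle_ineq)
    moreover have "norm (iter_deriv vs (\<lambda>z. h z * ?D g z) y) < \<epsilon> / 2"
      using small by (intro 2(3) Dg y) (auto simp: ball_Un)
    moreover have "norm (iter_deriv vs (\<lambda>z. ?D h z * g z) y) < \<epsilon> / 2"
      using small by (intro 1(3) g y) (auto simp: ball_Un)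
    ultimately show ?thesis by simp
  qed
  then show ?case
    using 1(1,2) 2(1,2)
    by (intro exI[of _ "W1 \<union> (#) v ` W2"] exI[of _ "min \<delta>1 \<delta>2"]) (auto simp del: iter_deriv.simps)
qed

subsection \<open>Finite-dimensional normed spaces\<close>

text \<open>Equivalence of norms in finite dimension, by compactness of the l1 unit sphere of
  coefficients: its image under the injective linear map \<open>?F\<close> is compact and misses
  0.\<close>

lemma independent_coefficients_bounded:
  fixes B :: "'e::real_normed_vector set"
  assumes "finite B" "Real_Vector_Spaces.independent B"
  shows "\<exists>C. \<forall>a. (\<Sum>b\<in>B. \<bar>a b\<bar>) \<le> C * norm (\<Sum>b\<in>B. a b *\<^sub>R b)"
proof -
  let ?N = "\<lambda>a::'e \<Rightarrow> real. \<Sum>b\<in>B. \<bar>a b\<bar>" and ?F = "\<lambda>a. \<Sum>b\<in>B. a b *\<^sub>R b"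
  \<comment> \<open>Coefficient vectors are functions on the whole space, pinned to 0 off
    \<open>B\<close>, so that the cube is a product of compact sets and Tychonoff applies.\<close>
  define P where "P = (\<Pi>\<^sub>E b\<in>UNIV. if b \<in> B then {-1..1::real} else {0})"
  have P: "a \<in> P \<longleftrightarrow> (\<forall>b. a b \<in> (if b \<in> B then {-1..1} else {0}))" for a
    by (auto simp: P_def PiE_iff)
  define K where "K = P \<inter> ?N -` {1}"
  have "compact P"
    using compactin_PiE[of "\<lambda>_::'e. euclidean :: real topology" UNIV
        "\<lambda>b. if b \<in> B then {-1..1} else {0}"]
    by (simp add: euclidean_product_topology P_def)
  moreover have "closed (?N -` {1})"
    by (intro closed_vimage closed_singleton continuous_on_sum continuous_on_rabs continuous_on_product_coordinates)
  ultimately have "compact K"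
    by (simp add: K_def compact_Int_closed)
  moreover have "continuous_on K ?F"
    by (intro continuous_intros continuous_on_subset[OF continuous_on_product_coordinates]) auto
  ultimately have "closed (?F ` K)"
    by (intro compact_imp_closed compact_continuous_image)
  moreover have "0 \<notin> ?F ` K"
  proof
    assume "0 \<in> ?F ` K"
    then obtain a where a: "a \<in> K" "?F a = 0" by auto
    then have "a b = 0" if "b \<in> B" for b
      using assms that real_vector.independentD[of B B a b] by auto
    then show False using a(1) by (simp add: K_def)
  qed
  ultimately have "open (- ?F ` K)" "0 \<in> - ?F ` K"
    by (simp_all add: open_Compl)
  \<comment> \<open>The ball of radius \<open>d\<close> misses the image of the sphere; 1/d becomes
    the constant of the lemma.\<close>
  then obtain d where d: "d > 0" "ball 0 d \<subseteq> - ?F ` K"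
    by (rule openE)
  have d_le: "d \<le> norm (?F a)" if "a \<in> K" for a
  proof (rule ccontr)
    assume "\<not> d \<le> norm (?F a)"
    then have "?F a \<in> ball 0 d"
      by simp
    then show False
      using d(2) that by blast
  qed
  have "?N a \<le> 1 / d * norm (?F a)" for a
  proof (cases "?N a = 0")
    case False
    then have pos: "?N a > 0"
      by (metis abs_ge_zero less_eq_real_def sum_nonneg)
    \<comment> \<open>Scaling to total absolute value 1 puts the coefficients on the sphere; the
      value 0 off \<open>B\<close> is what membership in \<open>P\<close> demands.\<close>
    define a' where "a' = (\<lambda>b. if b \<in> B then a b / ?N a else 0)"
    have le: "\<bar>a b\<bar> \<le> ?N a" if "b \<in> B" for b
      using assms(1) that by (intro member_le_sum) auto
    have "?N a' = ?N a / ?N a"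
      unfolding a'_def sum_divide_distrib using pos by (intro sum.cong) auto
    then have "a' \<in> K"
      using pos le by (fastforce simp: K_def P a'_def abs_le_iff divide_le_eq le_divide_eq)
    then have "d \<le> norm (?F a')"
      by (rule d_le)
    also have "?F a' = (1 / ?N a) *\<^sub>R ?F a"
      unfolding a'_def scaleR_sum_right by (intro sum.cong) auto
    finally show ?thesis
      using pos d(1) by (simp add: field_simps)
  qed (use d(1) in simp)
  then show ?thesis by blast
qed

lemma finite_span_bounded_coordinates:
  fixes B :: "'e::real_normed_vector set"
  assumes "finite B" "Real_Vector_Spaces.span B = UNIV"
  obtains D :: "'e set" and r where "finite D" "\<And>b. bounded_linear (r b)"
    "\<And>x. (\<Sum>b\<in>D. r b x *\<^sub>R b) = x"
proof -
  obtain D where D: "D \<subseteq> B" "Real_Vector_Spaces.independent D" "B \<subseteq> Real_Vector_Spaces.span D"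
    using real_vector.maximal_independent_subset[of B] by metis
  have sp: "Real_Vector_Spaces.span D = UNIV"
    using D(1,3) assms(2) by (metis real_vector.span_eq real_vector.span_superset subset_trans)
  have fin: "finite D"
    using D(1) assms(1) finite_subset by blast
  \<comment> \<open>The default 0 off \<open>D\<close> makes \<open>r b\<close> bounded linear for
    every \<open>b\<close>, with no side condition in later sums.\<close>
  define r where "r b x = (if b \<in> D then Real_Vector_Spaces.representation D x b else 0)" for b x
  have sum: "(\<Sum>b\<in>D. r b x *\<^sub>R b) = x" for x
    using real_vector.sum_representation_eq[OF D(2) _ fin, of x] sp by (simp add: r_def)
  obtain C where C: "\<And>a. (\<Sum>b\<in>D. \<bar>a b\<bar>) \<le> C * norm (\<Sum>b\<in>D. a b *\<^sub>R b)"
    using independent_coefficients_bounded[OF fin D(2)] by blast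
  have bound: "\<bar>r b x\<bar> \<le> norm x * C" if "b \<in> D" for b x
  proof -
    have "\<bar>r b x\<bar> \<le> (\<Sum>b\<in>D. \<bar>r b x\<bar>)"
      using fin that by (intro member_le_sum) auto
    also have "\<dots> \<le> C * norm x"
      using C[of "\<lambda>b. r b x"] sum by simp
    finally show ?thesis by (simp add: mult.commute)
  qed
  have "bounded_linear (r b)" for b
  proof (cases "b \<in> D")
    case True
    show ?thesis
    proof (rule bounded_linear_intro[of _ C])
      show "r b (x + y) = r b x + r b y" for x y
        using D(2) sp by (simp add: r_def real_vector.representation_add)
      show "r b (c *\<^sub>R x) = c *\<^sub>R r b x" for c x
        using D(2) sp by (simp add: r_def real_vector.representation_scale)
      show "norm (r b x) \<le> norm x * C" for x
        using bound[OF True] by simp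
    qed
  next
    case False
    then have "r b = (\<lambda>x. 0)"
      by (auto simp: r_def)
    then show ?thesis by simp
  qed
  then show ?thesis
    by (rule that[OF fin _ sum])
qed

text \<open>Expanding \<open>\<eta>\<close> in coordinates reduces this to derivatives in fixed directions.\<close>

lemma smooth_on_derivative_along_field:
  fixes B S :: "'e::real_normed_vector set"
  assumes "finite B" "Real_Vector_Spaces.span B = UNIV"
    and "open S" "smooth_on S f" "smooth_on S \<eta>"
  shows "smooth_on S (\<lambda>y. frechet_derivative f (at y) (\<eta> y))"
proof -
  obtain D :: "'e set" and r where D: "finite D" "\<And>b. bounded_linear (r b)"
    "\<And>x. (\<Sum>b\<in>D. r b x *\<^sub>R b) = x"
    by (rule finite_span_bounded_coordinates[OF assms(1,2)]) blast
  have "(\<Sum>b\<in>D. r b (\<eta> y) *\<^sub>R frechet_derivative f (at y) b) = frechet_derivative f (at y) (\<eta> y)"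
    if "y \<in> S" for y
  proof -
    have lin: "linear (frechet_derivative f (at y))"
      using smooth_on_has_derivative[OF assms(4) that] has_derivative_linear by blast
    have "frechet_derivative f (at y) (\<eta> y) =
        frechet_derivative f (at y) (\<Sum>b\<in>D. r b (\<eta> y) *\<^sub>R b)"
      by (simp only: D(3))
    also have "\<dots> = (\<Sum>b\<in>D. r b (\<eta> y) *\<^sub>R frechet_derivative f (at y) b)"
      by (simp add: linear_sum[OF lin] linear_scale[OF lin])
    finally show ?thesis by simp
  qed
  moreover have "smooth_on S (\<lambda>y. \<Sum>b\<in>D. r b (\<eta> y) *\<^sub>R frechet_derivative f (at y) b)"
    by (rule smooth_on_sum[OF assms(3) smooth_on_bilinear[OF assms(3) bounded_bilinear_scaleR
            smooth_on_bounded_linear[OF assms(3) D(2) assms(5)] smooth_on_frechet_derivative[OF assms(4)]]])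
  ultimately show ?thesis
    by (rule smooth_on_cong[OF assms(3)])
qed

section \<open>The algebra of smooth functions on a compact Lie group\<close>

lemma smooth_atlas_chart:
  assumes "smooth_atlas A" "(U, \<phi>) \<in> A"
  shows "open U" "open (\<phi> ` U)" "continuous_on U \<phi>" "continuous_on (\<phi> ` U) (inv_into U \<phi>)"
    "inj_on \<phi> U"
proof -
  have *: "open U \<and> open (\<phi> ` U) \<and> homeomorphism U (\<phi> ` U) \<phi> (inv_into U \<phi>)"
    using assms unfolding smooth_atlas_def by fast
  then show "open U" "open (\<phi> ` U)" "continuous_on U \<phi>" "continuous_on (\<phi> ` U) (inv_into U \<phi>)"
    by (auto simp: homeomorphism_def)
  show "inj_on \<phi> U"
    using * unfolding homeomorphism_def by (metis inj_on_inverseI)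
qed

lemma smooth_atlas_covers:
  assumes "smooth_atlas A"
  obtains U \<phi> where "(U, \<phi>) \<in> A" "x \<in> U"
proof -
  have "x \<in> (\<Union>(U, \<phi>)\<in>A. U)"
    using assms unfolding smooth_atlas_def by simp
  then show ?thesis
    using that by auto
qed

text \<open>Global continuity is recovered from the chart expressions because the open chart domains
  cover the group. Closure properties then become purely local.\<close>

lemma C_infinity_iff:
  assumes "smooth_atlas A"
  shows "f \<in> C_infinity A \<longleftrightarrow> (\<forall>(U, \<phi>)\<in>A. smooth_on (\<phi> ` U) (\<lambda>y. f (inv_into U \<phi> y)))"
proof -
  have "continuous_on UNIV f"
    if smooth: "\<forall>(U, \<phi>)\<in>A. smooth_on (\<phi> ` U) (\<lambda>y. f (inv_into U \<phi> y))"
  proof -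
    have "continuous_on U f" if U: "(U, \<phi>) \<in> A" for U \<phi>
    proof -
      note chart = smooth_atlas_chart[OF assms U]
      have "continuous_on (\<phi> ` U) (\<lambda>y. f (inv_into U \<phi> y))"
        using smooth U smooth_on_continuous by fast
      then have "continuous_on U (\<lambda>x. f (inv_into U \<phi> (\<phi> x)))"
        by (rule continuous_on_compose2[OF _ chart(3)]) simp
      then show ?thesis
        using chart(5) by (simp cong: continuous_on_cong)
    qed
    then have "continuous_on (\<Union>(fst ` A)) f"
      using smooth_atlas_chart(1)[OF assms] by (intro continuous_on_open_Union) auto
    moreover have "\<Union>(fst ` A) = UNIV"
      using assms by (simp add: smooth_atlas_def case_prod_unfold)
    ultimately show ?thesis by simp
  qed
  then show ?thesis
    by (auto simp: C_infinity_def smooth_map_def std_atlas_def o_def)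
qed

lemma C_infinityD:
  "smooth_atlas A \<Longrightarrow> f \<in> C_infinity A \<Longrightarrow> (U, \<phi>) \<in> A \<Longrightarrow>
    smooth_on (\<phi> ` U) (\<lambda>y. f (inv_into U \<phi> y))"
  using C_infinity_iff by fast

lemma C_infinity_const: "smooth_atlas A \<Longrightarrow> (\<lambda>x. c) \<in> C_infinity A"
  by (auto simp: C_infinity_iff intro!: smooth_on_const smooth_atlas_chart(2))

lemma C_infinity_add:
  "smooth_atlas A \<Longrightarrow> f \<in> C_infinity A \<Longrightarrow> g \<in> C_infinity A \<Longrightarrow> (\<lambda>x. f x + g x) \<in> C_infinity A"
  by (auto simp: C_infinity_iff intro!: smooth_on_add smooth_atlas_chart(2))

lemma C_infinity_mult:
  "smooth_atlas A \<Longrightarrow> f \<in> C_infinity A \<Longrightarrow> g \<in> C_infinity A \<Longrightarrow> (\<lambda>x. f x * g x) \<in> C_infinity A"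
  by (auto simp: C_infinity_iff intro!: smooth_on_mult smooth_atlas_chart(2))

lemma C_infinity_exp:
  "smooth_atlas A \<Longrightarrow> f \<in> C_infinity A \<Longrightarrow> (\<lambda>x. exp (f x)) \<in> C_infinity A"
  by (auto simp: C_infinity_iff intro!: smooth_on_exp smooth_atlas_chart(2))

lemma C_infinity_uminus:
  "smooth_atlas A \<Longrightarrow> f \<in> C_infinity A \<Longrightarrow> (\<lambda>x. - f x) \<in> C_infinity A"
  using C_infinity_mult[OF _ C_infinity_const, of A f "-1"] by simp

section \<open>The left-invariant field: chart formula, smoothness, Leibniz rule\<close>

lemma one_parameter_zero:
  assumes "X \<in> lie_algebra A"
  shows "X 0 = 1"
proof -
  have "X (0 + 0) = X 0 * X 0"
    using assms unfolding lie_algebra_def by blast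
  then have "inverse (X 0) * X 0 = inverse (X 0) * X 0 * X 0"
    by (simp add: mult.assoc)
  then show ?thesis
    by (simp add: left_inverse_mult)
qed

text \<open>In a chart, \<open>X\<close> is differentiation along the field \<open>\<eta>(y) = D m(y, e)(0, c'(0))\<close>, where \<open>m\<close> is the
  group multiplication and \<open>c\<close> the one-parameter subgroup, both read in charts.\<close>

lemma left_inv_field_in_chart:
  fixes A :: "('g::{group_mult,t2_space,second_countable_topology}, 'e::real_normed_vector) atlas"
  assumes "compact_lie_group A" "X \<in> lie_algebra A" "(U, \<phi>) \<in> A"
  obtains \<eta> where "smooth_on (\<phi> ` U) \<eta>"
    "\<And>f x. f \<in> C_infinity A \<Longrightarrow> x \<in> U \<Longrightarrow>
      ((\<lambda>t. f (x * X t)) has_vector_derivative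
        frechet_derivative (\<lambda>y. f (inv_into U \<phi> y)) (at (\<phi> x)) (\<eta> (\<phi> x))) (at 0)"
proof -
  have atlas: "smooth_atlas A"
    and mult: "smooth_map (prod_atlas A A) A (\<lambda>(x, y). x * y)"
    using assms(1) by (auto simp: compact_lie_group_def)
  have X: "smooth_map (std_atlas :: (real, real) atlas) A X"
    using assms(2) by (simp add: lie_algebra_def)
  have mult_cont: "continuous_on UNIV (\<lambda>(x, y). x * y :: 'g)" and X_cont: "continuous_on UNIV X"
    using mult X by (simp_all add: smooth_map_def)
  obtain W \<psi> where W: "(W, \<psi>) \<in> A" "1 \<in> W"
    using smooth_atlas_covers[OF atlas] .
  note U_chart = smooth_atlas_chart[OF atlas assms(3)]
    and W_chart = smooth_atlas_chart[OF atlas W(1)]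
  \<comment> \<open>Pairs whose product returns to \<open>U\<close>. One chart \<open>U\<close>
    serves as source and target since x * 1 = x, so the image \<open>R\<close> contains
    \<open>(\<phi> x, \<psi> 1)\<close> for every x in \<open>U\<close>.\<close>
  define P where "P = (U \<times> W) \<inter> (\<lambda>(x, y). x * y) -` U"
  define R where "R = map_prod \<phi> \<psi> ` P"
  define m where "m = \<phi> \<circ> (\<lambda>(x, y). x * y) \<circ> inv_into (U \<times> W) (map_prod \<phi> \<psi>)"
  have inj: "inj_on (map_prod \<phi> \<psi>) (U \<times> W)"
    using U_chart(5) W_chart(5) by (rule map_prod_inj_on)
  have "(U \<times> W, map_prod \<phi> \<psi>) \<in> prod_atlas A A"
    using assms(3) W(1) by (auto simp: prod_atlas_def)
  then have m_smooth: "smooth_on R m"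
    using mult assms(3) unfolding smooth_map_def R_def P_def m_def by fast
  have m: "m (\<phi> x, \<psi> z) = \<phi> (x * z)" if "x \<in> U" "z \<in> W" for x z
    using inv_into_f_f[OF inj, of "(x, z)"] that by (simp add: m_def)
  have unit_in_R: "(y, \<psi> 1) \<in> R" if "y \<in> \<phi> ` U" for y
    using that W(2) by (force simp: R_def P_def)
  define c where "c = (\<lambda>t. \<psi> (X t))"
  have X0: "X 0 = 1"
    using assms(2) by (rule one_parameter_zero)
  have "smooth_on (X -` W) c"
    using X W(1) by (auto simp: smooth_map_def std_atlas_def c_def o_def id_def)
  then have "(c has_derivative frechet_derivative c (at 0)) (at 0)"
    using X0 W(2) smooth_on_has_derivative by fastforce
  then have c: "(c has_vector_derivative vector_derivative c (at 0)) (at 0)"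
    using differentiableI vector_derivative_works by blast
  define v where "v = vector_derivative c (at 0)"
  define \<eta> where "\<eta> y = frechet_derivative m (at (y, \<psi> 1)) (0, v)" for y
  show ?thesis
  proof
    show "smooth_on (\<phi> ` U) \<eta>"
      unfolding \<eta>_def
      by (rule smooth_on_slice[OF U_chart(2) smooth_on_frechet_derivative[OF m_smooth] unit_in_R])
  next
    fix f x
    assume f: "f \<in> C_infinity A" and x: "x \<in> U"
    let ?f = "\<lambda>y. f (inv_into U \<phi> y)"
    let ?f' = "frechet_derivative ?f (at (\<phi> x))"
      and ?m' = "frechet_derivative m (at (\<phi> x, \<psi> 1))"
    have f': "(?f has_derivative ?f') (at (\<phi> x))"
      using x by (intro smooth_on_has_derivative[OF C_infinityD[OF atlas f assms(3)]]) simp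
    have m': "(m has_derivative ?m') (at (\<phi> x, \<psi> 1))"
      using x by (intro smooth_on_has_derivative[OF m_smooth] unit_in_R) simp
    have "((\<lambda>t. (\<phi> x, c t)) has_derivative (\<lambda>t. (0, t *\<^sub>R v))) (at 0)"
      using c unfolding has_vector_derivative_def v_def
      by (intro has_derivative_Pair has_derivative_const) auto
    moreover have "c 0 = \<psi> 1" "m (\<phi> x, \<psi> 1) = \<phi> x"
      using m[OF x W(2)] X0 by (simp_all add: c_def)
    ultimately have "((\<lambda>t. ?f (m (\<phi> x, c t))) has_derivative (\<lambda>t. ?f' (?m' (0, t *\<^sub>R v)))) (at 0)"
      using f' m' by (intro has_derivative_compose[of "\<lambda>t. m (\<phi> x, c t)" _ _ _ ?f]
          has_derivative_compose[of "\<lambda>t. (\<phi> x, c t)" _ _ _ m]) simp_all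
    moreover have "?f' (?m' (0, t *\<^sub>R v)) = t *\<^sub>R ?f' (\<eta> (\<phi> x))" for t
    proof -
      have "linear ?f'" "linear ?m'"
        using f' m' has_derivative_linear by blast+
      then show ?thesis
        using linear_scale[of ?m' t "(0, v)"] linear_scale[of ?f' t] by (simp add: \<eta>_def)
    qed
    ultimately have deriv: "((\<lambda>t. ?f (m (\<phi> x, c t))) has_vector_derivative ?f' (\<eta> (\<phi> x))) (at 0)"
      by (simp add: has_vector_derivative_def)
    \<comment> \<open>The chart formula is valid while \<open>X t\<close> stays in \<open>W\<close>
      and \<open>x * X t\<close> in \<open>U\<close>. By continuity these times form an open set
      containing 0, which is all that a derivative at 0 sees.\<close>
    define T where "T = X -` W \<inter> (\<lambda>t. x * X t) -` U"
    have "continuous_on UNIV (\<lambda>t. x * X t)"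
      using continuous_on_compose2[OF mult_cont, of UNIV "\<lambda>t. (x, X t)"] X_cont
      by (simp add: continuous_on_Pair)
    then have "open T"
      unfolding T_def using X_cont U_chart(1) W_chart(1)
      by (intro open_Int open_vimage)
    moreover have "0 \<in> T"
      using x W(2) X0 by (simp add: T_def)
    moreover have "?f (m (\<phi> x, c t)) = f (x * X t)" if "t \<in> T" for t
      using that x m U_chart(5) by (simp add: T_def c_def)
    ultimately show "((\<lambda>t. f (x * X t)) has_vector_derivative ?f' (\<eta> (\<phi> x))) (at 0)"
      by (rule has_vector_derivative_transform_within_open[OF deriv])
  qed
qed

lemma left_inv_field_alt: "left_inv_field X f x = vector_derivative (\<lambda>t. f (x * X t)) (at 0)"
  by (simp add: left_inv_field_def lie_exp_def lie_scale_def)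

text \<open>\<open>left_inv_field\<close> is defined by a total \<open>vector_derivative\<close>;
  existence of the derivative must be known before the chain and product rules can be used.\<close>

lemma left_inv_field_works:
  assumes "compact_lie_group A" "X \<in> lie_algebra A" "f \<in> C_infinity A"
  shows "((\<lambda>t. f (x * X t)) has_vector_derivative left_inv_field X f x) (at 0)"
proof -
  have "smooth_atlas A"
    using assms(1) by (simp add: compact_lie_group_def)
  then obtain U \<phi> where U: "(U, \<phi>) \<in> A" "x \<in> U"
    by (rule smooth_atlas_covers)
  obtain d where "((\<lambda>t. f (x * X t)) has_vector_derivative d) (at 0)"
    by (rule left_inv_field_in_chart[OF assms(1,2) U(1)]) (use assms(3) U(2) in blast)
  then show ?thesis
    unfolding left_inv_field_alt by (simp add: vector_derivative_at)
qed

text \<open>In a chart, X f is the derivative of the local expression of \<open>f\<close> in the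
  smoothly varying direction \<open>\<eta> y\<close>, so smoothness along a field applies.\<close>

lemma C_infinity_left_inv_field:
  assumes "compact_lie_group A" "X \<in> lie_algebra A" "f \<in> C_infinity A"
  shows "left_inv_field X f \<in> C_infinity A"
proof -
  have atlas: "smooth_atlas A"
    using assms(1) by (simp add: compact_lie_group_def)
  then obtain B :: "'b set" where B: "finite B" "Real_Vector_Spaces.span B = UNIV"
    by (auto simp: smooth_atlas_def)
  have "smooth_on (\<phi> ` U) (\<lambda>y. left_inv_field X f (inv_into U \<phi> y))" if U: "(U, \<phi>) \<in> A" for U \<phi>
  proof -
    note chart = smooth_atlas_chart[OF atlas U]
    obtain \<eta> where \<eta>: "smooth_on (\<phi> ` U) \<eta>"
      "\<And>x. x \<in> U \<Longrightarrow> ((\<lambda>t. f (x * X t)) has_vector_derivative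
        frechet_derivative (\<lambda>y. f (inv_into U \<phi> y)) (at (\<phi> x)) (\<eta> (\<phi> x))) (at 0)"
      by (rule left_inv_field_in_chart[OF assms(1,2) U]) (use assms(3) in blast)
    have "frechet_derivative (\<lambda>y. f (inv_into U \<phi> y)) (at y) (\<eta> y) = left_inv_field X f (inv_into U \<phi> y)"
      if "y \<in> \<phi> ` U" for y
      using vector_derivative_at[OF \<eta>(2)[OF inv_into_into[OF that]]] that
      by (simp add: left_inv_field_alt f_inv_into_f)
    then show ?thesis
      using smooth_on_derivative_along_field[OF B chart(2) C_infinityD[OF atlas assms(3) U] \<eta>(1)]
      by (rule smooth_on_cong[OF chart(2)])
  qed
  then show ?thesis
    using C_infinity_iff[OF atlas] by fast
qed

lemma left_inv_field_exp_mult: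
  assumes "compact_lie_group A" "X \<in> lie_algebra A" "Q \<in> C_infinity A" "f \<in> C_infinity A"
  shows "left_inv_field X (\<lambda>x. exp (Q x) * f x) x =
    exp (Q x) * left_inv_field X f x + left_inv_field X Q x * (exp (Q x) * f x)"
proof -
  note Q' = left_inv_field_works[OF assms(1-3), of x]
    and f' = left_inv_field_works[OF assms(1,2,4), of x]
  have "((\<lambda>t. exp (Q (x * X t))) has_vector_derivative left_inv_field X Q x * exp (Q (x * X 0))) (at 0)"
    using field_vector_diff_chain_at[OF Q' DERIV_exp] by (simp add: o_def)
  from has_vector_derivative_mult[OF this f'] show ?thesis
    using one_parameter_zero[OF assms(2)] vector_derivative_at
    by (simp add: left_inv_field_alt[of X "\<lambda>x. exp (Q x) * f x"] vector_derivative_at mult.assoc)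
qed

section \<open>Multiplication of distributions by smooth functions\<close>

lemma openin_C_infinity_topology_basic:
  assumes "f \<in> C_infinity A" "(U, \<phi>) \<in> A" "compact K" "K \<subseteq> \<phi> ` U" "0 < \<epsilon>"
  shows "openin (C_infinity_topology A) {g \<in> C_infinity A. \<forall>y\<in>K.
    norm (iter_deriv vs (\<lambda>y. g (inv_into U \<phi> y)) y - iter_deriv vs (\<lambda>y. f (inv_into U \<phi> y)) y) < \<epsilon>}"
  unfolding C_infinity_topology_def
  by (rule topology_generated_by_Basis) (use assms in \<open>unfold o_def, blast\<close>)

lemma topspace_C_infinity_topology:
  assumes "smooth_atlas A"
  shows "topspace (C_infinity_topology A) = C_infinity A"
proof
  obtain U \<phi> where U: "(U, \<phi>) \<in> A"
    by (rule smooth_atlas_covers[OF assms])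
  have "openin (C_infinity_topology A) (C_infinity A)"
    \<comment> \<open>For the empty compact set the defining condition is vacuous, and the
      generating set is all of \<open>C_infinity A\<close>.\<close>
    using openin_C_infinity_topology_basic[OF C_infinity_const[OF assms, of 0] U, of "{}" 1] by simp
  then show "C_infinity A \<subseteq> topspace (C_infinity_topology A)"
    by (rule openin_subset)
  show "topspace (C_infinity_topology A) \<subseteq> C_infinity A"
    unfolding C_infinity_topology_def topology_generated_by_topspace by auto
qed

text \<open>Preimages need only be tested on generating sets. By linearity h g - f0 = h (g - f) + (h
  f - f0): the second term stays below \<epsilon> on \<open>K\<close> by a uniform margin, and
  \<open>iter_deriv_mult_small\<close> fits the first into that margin.\<close>

lemma continuous_map_mult_C_infinity:
  assumes "smooth_atlas A" "h \<in> C_infinity A"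
  shows "continuous_map (C_infinity_topology A) (C_infinity_topology A) (\<lambda>f x. h x * f x)"
proof -
  let ?T = "C_infinity_topology A"
  have top: "topspace ?T = C_infinity A"
    by (rule topspace_C_infinity_topology[OF assms(1)])
  have *: "openin ?T ((\<lambda>f x. h x * f x) -` N \<inter> topspace ?T)"
    if N: "N = {g \<in> C_infinity A. \<forall>y\<in>K.
        norm (iter_deriv vs (g \<circ> inv_into U \<phi>) y - iter_deriv vs (f0 \<circ> inv_into U \<phi>) y) < \<epsilon>}"
      and f0: "f0 \<in> C_infinity A" and U: "(U, \<phi>) \<in> A" and K: "compact K" "K \<subseteq> \<phi> ` U" and "0 < \<epsilon>"
    for N f0 U \<phi> K vs and \<epsilon> :: real
  proof (subst openin_subopen, safe)
    fix f
    assume f: "f \<in> topspace ?T" and hf: "(\<lambda>x. h x * f x) \<in> N"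
    note chart = smooth_atlas_chart[OF assms(1) U]
    let ?l = "\<lambda>g y. g (inv_into U \<phi> y)"
    note sm = C_infinityD[OF assms(1) _ U]
    have fC: "f \<in> C_infinity A"
      using f top by simp
    note hfC = C_infinity_mult[OF assms fC]
    let ?d = "\<lambda>y. norm (iter_deriv vs (\<lambda>y. ?l h y * ?l f y) y - iter_deriv vs (?l f0) y)"
    have lt: "?d y < \<epsilon>" if "y \<in> K" for y
      using hf that by (simp add: N o_def)
    \<comment> \<open>The margin \<delta> comes from the maximum of \<open>?d\<close> on the compact
      set \<open>K\<close>; the empty set has no maximum and is treated apart.\<close>
    have "\<exists>\<delta>>0. \<forall>y\<in>K. ?d y \<le> \<epsilon> - \<delta>"
    proof (cases "K = {}")
      case False
      have "continuous_on K ?d"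
        using sm[OF hfC] sm[OF f0] K(2)
        by (intro continuous_intros) (auto intro: continuous_on_subset[OF continuous_on_iter_deriv])
      then obtain y0 where "y0 \<in> K" "\<And>y. y \<in> K \<Longrightarrow> ?d y \<le> ?d y0"
        using continuous_attains_sup[OF K(1) False] by blast
      then show ?thesis
        using lt by (intro exI[of _ "\<epsilon> - ?d y0"]) simp
    qed (auto intro: exI[of _ 1])
    then obtain \<delta> where \<delta>: "\<delta> > 0" "\<And>y. y \<in> K \<Longrightarrow> ?d y \<le> \<epsilon> - \<delta>"
      by blast
    obtain Ws \<gamma> where Ws: "finite Ws" "0 < \<gamma>" "\<And>g y. smooth_on (\<phi> ` U) g \<Longrightarrow>
        (\<forall>ws\<in>Ws. \<forall>y\<in>K. norm (iter_deriv ws g y) < \<gamma>) \<Longrightarrow> y \<in> K \<Longrightarrow>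
        norm (iter_deriv vs (\<lambda>x. ?l h x * g x) y) < \<delta>"
      using iter_deriv_mult_small[OF chart(2) K sm[OF assms(2)] \<delta>(1), of vs] by blast
    define M where "M ws = {g \<in> C_infinity A. \<forall>y\<in>K. norm (iter_deriv ws (?l g) y - iter_deriv ws (?l f) y) < \<gamma>}"
      for ws
    \<comment> \<open>The factor \<open>topspace ?T\<close> keeps \<open>V\<close> inside the space
      even when \<open>Ws\<close> is empty and the intersection is everything.\<close>
    define V where "V = topspace ?T \<inter> (\<Inter>ws\<in>Ws. M ws)"
    have "openin ?T (M ws)" for ws
      unfolding M_def by (rule openin_C_infinity_topology_basic[OF fC U K Ws(2)])
    then have "openin ?T V"
      unfolding V_def using Ws(1) by (intro openin_Int_Inter) auto
    moreover have "f \<in> V"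
      using f fC Ws(2) by (simp add: V_def M_def)
    moreover have "V \<subseteq> (\<lambda>f x. h x * f x) -` N \<inter> topspace ?T"
    proof
      fix g
      assume g: "g \<in> V"
      then have gC: "g \<in> C_infinity A"
        by (simp add: V_def top)
      note hgC = C_infinity_mult[OF assms gC]
      have "norm (iter_deriv vs (\<lambda>y. ?l h y * ?l g y) y - iter_deriv vs (?l f0) y) < \<epsilon>" if y: "y \<in> K" for y
      proof -
        have yU: "y \<in> \<phi> ` U"
          using y K(2) by blast
        have "\<forall>ws\<in>Ws. \<forall>y\<in>K. norm (iter_deriv ws (\<lambda>y. ?l g y - ?l f y) y) < \<gamma>"
          using g K(2) iter_deriv_diff[OF chart(2) sm[OF gC] sm[OF fC]]
          by (auto simp: V_def M_def subset_iff)
        then have "norm (iter_deriv vs (\<lambda>y. ?l h y * (?l g y - ?l f y)) y) < \<delta>"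
          by (rule Ws(3)[OF smooth_on_diff[OF chart(2) sm[OF gC] sm[OF fC]] _ y])
        also have "(\<lambda>y. ?l h y * (?l g y - ?l f y)) = (\<lambda>y. ?l h y * ?l g y - ?l h y * ?l f y)"
          by (simp add: right_diff_distrib)
        also have "iter_deriv vs \<dots> y =
            iter_deriv vs (\<lambda>y. ?l h y * ?l g y) y - iter_deriv vs (\<lambda>y. ?l h y * ?l f y) y"
          by (rule iter_deriv_diff[OF chart(2) sm[OF hgC] sm[OF hfC] yU])
        finally show ?thesis
          using \<delta>(2)[OF y] norm_triangle_ineq[of
              "iter_deriv vs (\<lambda>y. ?l h y * ?l g y) y - iter_deriv vs (\<lambda>y. ?l h y * ?l f y) y"
              "iter_deriv vs (\<lambda>y. ?l h y * ?l f y) y - iter_deriv vs (?l f0) y"] by simp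
      qed
      then show "g \<in> (\<lambda>f x. h x * f x) -` N \<inter> topspace ?T"
        using gC hgC by (simp add: N top o_def)
    qed
    ultimately show "\<exists>V. openin ?T V \<and> f \<in> V \<and> V \<subseteq> (\<lambda>f x. h x * f x) -` N \<inter> topspace ?T"
      by blast
  qed
  have **: "(\<lambda>f x. h x * f x) ` topspace ?T \<subseteq> topspace ?T"
    using C_infinity_mult[OF assms] by (auto simp: top)
  show ?thesis
  \<comment> \<open>Only the target topology is unfolded into its generating family; the source
    stays folded so that \<open>*\<close> applies.\<close>
  proof (subst (2) C_infinity_topology_def, rule continuous_on_generated_topo)
    show "(\<lambda>f x. h x * f x) ` topspace ?T \<subseteq> \<Union> {{g \<in> C_infinity A. \<forall>y\<in>K.
         norm (iter_deriv vs (g \<circ> inv_into U \<phi>) y - iter_deriv vs (f \<circ> inv_into U \<phi>) y) < \<epsilon>}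
       | f U \<phi> K vs \<epsilon>.
         f \<in> C_infinity A \<and> (U, \<phi>) \<in> A \<and> compact K \<and> K \<subseteq> \<phi> ` U \<and> (0::real) < \<epsilon>}"
      using ** by (subst (asm) (2) C_infinity_topology_def) (simp only: topology_generated_by_topspace)
  qed (elim CollectE exE conjE, rule *, assumption+)
qed

lemma mult_distribution_in_distributions:
  assumes "smooth_atlas A" "h \<in> C_infinity A" "u \<in> distributions A"
  shows "mult_distribution A h u \<in> distributions A"
proof -
  let ?v = "\<lambda>f. u (\<lambda>x. h x * f x)"
  have u_add: "u (\<lambda>x. f x + g x) = u f + u g" if "f \<in> C_infinity A" "g \<in> C_infinity A" for f g
    using assms(3) that by (simp add: distributions_def)
  have u_scale: "u (\<lambda>x. c * f x) = c * u f" if "f \<in> C_infinity A" for c f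
    using assms(3) that by (simp add: distributions_def)
  have u_cont: "continuous_map (C_infinity_topology A) euclidean u"
    using assms(3) by (simp add: distributions_def)
  note hC = C_infinity_mult[OF assms(1,2)]
  note sumC = C_infinity_add[OF assms(1)]
  have scaleC: "(\<lambda>x. c * f x) \<in> C_infinity A" if "f \<in> C_infinity A" for c f
    by (rule C_infinity_mult[OF assms(1) C_infinity_const[OF assms(1)] that])
  have "continuous_map (C_infinity_topology A) euclidean ?v"
    using continuous_map_compose[OF continuous_map_mult_C_infinity[OF assms(1,2)] u_cont]
    by (simp add: o_def)
  then have "continuous_map (C_infinity_topology A) euclidean (restrict ?v (C_infinity A))"
    by (rule continuous_map_eq) (simp add: topspace_C_infinity_topology[OF assms(1)])
  moreover have "?v (\<lambda>x. f x + g x) = ?v f + ?v g" if "f \<in> C_infinity A" "g \<in> C_infinity A" for f g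
    using u_add[OF hC hC, OF that] by (simp add: distrib_left)
  moreover have "?v (\<lambda>x. c * f x) = c * ?v f" if "f \<in> C_infinity A" for c f
    using u_scale[OF hC[OF that], of c] by (simp add: mult.left_commute)
  ultimately show ?thesis
    by (simp add: distributions_def mult_distribution_def sumC scaleC)
qed

text \<open>Stated for extensional functionals so that it also covers L_q u. Smoothness of
  \<open>g\<close> keeps \<open>g x * f x\<close> a test function, where the inner restricted
  functional has its intended value.\<close>

lemma mult_distribution_cancel:
  assumes "smooth_atlas A" "g \<in> C_infinity A" "\<And>x. h x * g x = 1" "u \<in> extensional (C_infinity A)"
  shows "mult_distribution A g (mult_distribution A h u) = u"
proof (rule extensionalityI[of _ "C_infinity A"])
  fix f
  assume f: "f \<in> C_infinity A"
  have "(\<lambda>x. h x * (g x * f x)) = f"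
    by (simp add: mult.assoc[symmetric] assms(3))
  then show "mult_distribution A g (mult_distribution A h u) f = u f"
    using f C_infinity_mult[OF assms(1,2) f] by (simp add: mult_distribution_def)
qed (use assms(4) in \<open>simp_all add: mult_distribution_def\<close>)

section \<open>Conjugation of L_q into L_{q_0} and transport of solvability\<close>

lemma L_op_conjugate:
  assumes "compact_lie_group A" "X \<in> lie_algebra A" "q \<in> C_infinity A" "Q \<in> C_infinity A"
    and Q: "\<And>x. left_inv_field X Q x = q x - q0" and u: "u \<in> distributions A"
  shows "L_op A X (\<lambda>x. q0) (mult_distribution A (\<lambda>x. exp (Q x)) u) =
    mult_distribution A (\<lambda>x. exp (Q x)) (L_op A X q u)"
proof -
  have atlas: "smooth_atlas A"
    using assms(1) by (simp add: compact_lie_group_def)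
  note mult = C_infinity_mult[OF atlas]
    and field = C_infinity_left_inv_field[OF assms(1,2)]
    and const = C_infinity_const[OF atlas]
  have u_add: "u (\<lambda>x. f x + g x) = u f + u g" if "f \<in> C_infinity A" "g \<in> C_infinity A" for f g
    using u that by (simp add: distributions_def)
  have u_scale: "u (\<lambda>x. c * f x) = c * u f" if "f \<in> C_infinity A" for c f
    using u that by (simp add: distributions_def)
  have "L_op A X (\<lambda>x. q0) (mult_distribution A (\<lambda>x. exp (Q x)) u) f =
      mult_distribution A (\<lambda>x. exp (Q x)) (L_op A X q u) f" if f: "f \<in> C_infinity A" for f
  proof -
    \<comment> \<open>Both sides are tested on \<open>f\<close>, with e^Q moved to the test
      function. Expanding X b on the right cancels u(q b), and both sides reduce to - u(a) + q_0
      u(b).\<close>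
    define a where "a = (\<lambda>x. exp (Q x) * left_inv_field X f x)"
    define b where "b = (\<lambda>x. exp (Q x) * f x)"
    have C: "a \<in> C_infinity A" "b \<in> C_infinity A"
      using mult field C_infinity_exp[OF atlas assms(4)] f by (simp_all add: a_def b_def)
    have "left_inv_field X b = (\<lambda>x. a x + (q x * b x + - q0 * b x))"
      unfolding b_def a_def fun_eq_iff left_inv_field_exp_mult[OF assms(1,2,4) f] Q
      by (simp add: algebra_simps)
    then have "u (left_inv_field X b) = u a + (u (\<lambda>x. q x * b x) + u (\<lambda>x. - q0 * b x))"
      using u_add[OF mult[OF assms(3) C(2)] mult[OF const[of "- q0"] C(2)]]
        u_add[OF C(1) C_infinity_add[OF atlas mult[OF assms(3) C(2)] mult[OF const[of "- q0"] C(2)]]]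
      by simp
    moreover have "u (\<lambda>x. - q0 * b x) = - q0 * u b" "u (\<lambda>x. exp (Q x) * (q0 * f x)) = q0 * u b"
      using u_scale[OF C(2), of "- q0"] u_scale[OF C(2), of q0]
      by (simp_all add: b_def mult.left_commute)
    moreover have "exp (Q x) * left_inv_field X f x = a x" "exp (Q x) * f x = b x" for x
      by (simp_all add: a_def b_def)
    ultimately show ?thesis
      using f C(2) field[OF f] mult[OF const f]
      by (simp add: L_op_def mult_distribution_def)
  qed
  then show ?thesis
    by (intro extensionalityI[of _ "C_infinity A"]) (simp_all add: L_op_def mult_distribution_def)
qed

lemma globally_solvable_conjugate:
  assumes "compact_lie_group A" "X \<in> lie_algebra A" "q \<in> C_infinity A" "Q \<in> C_infinity A"
    and "\<And>x. left_inv_field X Q x = q x - q0"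
  shows "L_op A X q ` distributions A = J_space A X rep q0 Q \<longleftrightarrow>
    globally_solvable_const A X rep q0"
proof -
  let ?T = "mult_distribution A (\<lambda>x. exp (Q x))" and ?S = "mult_distribution A (\<lambda>x. exp (- Q x))"
  let ?D = "distributions A" and ?E = "extensional (C_infinity A)"
  have atlas: "smooth_atlas A"
    using assms(1) by (simp add: compact_lie_group_def)
  note expC = C_infinity_exp[OF atlas assms(4)] C_infinity_exp[OF atlas C_infinity_uminus[OF atlas assms(4)]]
  have T: "?T u \<in> ?D" and S: "?S u \<in> ?D" if "u \<in> ?D" for u
    using mult_distribution_in_distributions[OF atlas _ that] expC by blast+
  have ST: "?S (?T u) = u" and TS: "?T (?S u) = u" if "u \<in> ?E" for u
    using mult_distribution_cancel[OF atlas expC(2) _ that] mult_distribution_cancel[OF atlas expC(1) _ that]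
    by (simp_all add: exp_add[symmetric])
  have D: "?D \<subseteq> ?E"
    by (auto simp: distributions_def)
  have L: "L_op A X q ` ?D \<subseteq> ?E"
    by (auto simp: L_op_def)
  have J: "J_space A X rep q0 Q \<subseteq> ?E"
    using D by (auto simp: J_space_def)
  have K: "K_space A X rep q0 \<subseteq> ?D"
    by (auto simp: K_space_def)
  have TD: "?T ` ?D = ?D"
  proof
    show "?D \<subseteq> ?T ` ?D"
    proof
      fix w
      assume w: "w \<in> ?D"
      show "w \<in> ?T ` ?D"
        using TS[OF subsetD[OF D w]] S[OF w] by (intro image_eqI[of w ?T "?S w"]) simp_all
    qed
  qed (use T in blast)
  have TJ: "?T ` J_space A X rep q0 Q = K_space A X rep q0"
  proof
    show "?T ` J_space A X rep q0 Q \<subseteq> K_space A X rep q0"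
      by (auto simp: J_space_def)
    show "K_space A X rep q0 \<subseteq> ?T ` J_space A X rep q0 Q"
    proof
      fix w
      assume w: "w \<in> K_space A X rep q0"
      then have "?S w \<in> J_space A X rep q0 Q" "w = ?T (?S w)"
        using K D S TS by (auto simp: J_space_def)
      then show "w \<in> ?T ` J_space A X rep q0 Q" by blast
    qed
  qed
  have TL: "?T ` L_op A X q ` ?D = L_op A X (\<lambda>x. q0) ` ?D"
  proof -
    have "?T ` L_op A X q ` ?D = L_op A X (\<lambda>x. q0) ` ?T ` ?D"
      unfolding image_image using L_op_conjugate[OF assms] by (intro image_cong) auto
    then show ?thesis using TD by simp
  qed
  \<comment> \<open>Both L_q(D') and J_q lie in \<open>?E\<close>, where \<open>?S\<close> is a left
    inverse of \<open>?T\<close>; equality of their images is therefore equivalent to equality of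
    the sets themselves.\<close>
  have "inj_on ?T ?E"
    by (rule inj_on_inverseI[where g = ?S]) (rule ST)
  then have "?T ` L_op A X q ` ?D = ?T ` J_space A X rep q0 Q \<longleftrightarrow>
      L_op A X q ` ?D = J_space A X rep q0 Q"
    using L J by (rule inj_on_image_eq_iff)
  then show ?thesis
    unfolding globally_solvable_const_def TL TJ by simp
qed

theorem proposition5p10:
  fixes A :: "('g::{group_mult,t2_space,second_countable_topology}, 'e::real_normed_vector) atlas"
    and M :: "'g measure"
    and X :: "real \<Rightarrow> 'g"
    and rep :: "('g \<Rightarrow> complex mat) set \<Rightarrow> 'g \<Rightarrow> complex mat"
    and q :: "'g \<Rightarrow> complex"
    and q0 :: complex
  assumes "compact_lie_group A"
    and "normalized_haar M"
    and "X \<in> lie_algebra A"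
    and "diagonalizing_representatives X rep"
    and "q \<in> C_infinity A"
    and "q0 = (LINT x|M. q x)"
    and "\<exists>Q\<in>C_infinity A. \<forall>x. left_inv_field X Q x = q x - q0"
  shows "globally_solvable A M X rep q \<longleftrightarrow> globally_solvable_const A X rep q0"
proof -
  \<comment> \<open>The right-hand side does not mention \<open>Q\<close>, so the equation has the
    same truth value for every primitive. Any witness in \<open>globally_solvable\<close> gives one
    direction, the assumed primitive the other.\<close>
  have "L_op A X q ` distributions A = J_space A X rep q0 Q \<longleftrightarrow> globally_solvable_const A X rep q0"
    if "Q \<in> C_infinity A" "\<forall>x. left_inv_field X Q x = q x - q0" for Q
    using globally_solvable_conjugate[OF assms(1,3,5) that(1)] that(2) by blast
  then show ?thesis
    using assms(7) unfolding globally_solvable_def Let_def assms(6)[symmetric] by blast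
qed

end
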